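(* A digraph $H$ admits a conservative majority polymorphism if and only if $H$ has no permutable triple.
   Context: A digraph $H$ is a finite set $V(H)$ with a binary relation $E(H)$ (arcs). A ternary polymorphism of $H$ is a map $\mu:V(H)^3\to V(H)$ such that whenever $u_1v_1,u_2v_2,u_3v_3\in E(H)$, also $\mu(u_1,u_2,u_3)\mu(v_1,v_2,v_3)\in E(H)$. It is conservative if $\mu(a,b,c)\in\{a,b,c\}$ always, and a majority function if $\mu(a,a,b)=\mu(a,b,a)=\mu(b,a,a)=a$ for all $a,b$. A walk in $H$ is a sequence $x_0,\dots,x_n$ of vertices together with, for each $i$, a designation of step $i$ as forward (requiring $x_ix_{i+1}\in E(H)$) or backward (requiring $x_{i+1}x_i\in E(H)$). Two walks $P=x_0,\dots,x_n$ and $Q=y_0,\dots,y_n$ are congruent if for every $i$ step $i$ of $P$ is forward iff step $i$ of $Q$ is forward. For congruent $P,Q$, $P$ avoids $Q$ if there is no $i$ with step $i$ forward and $x_iy_{i+1}\in E(H)$, and no $i$ with step $i$ backward and $y_{i+1}x_i\in E(H)$. A permutable triple consists of three distinct vertices $u,v,w$ together with six vertices $s(u),b(u),s(v),b(v),s(w),b(w)$ such that for each $x\in\{u,v,w\}$, with $y,z$ the other two, there exist a walk $P(x,s(x))$ from $x$ to $s(x)$ and walks $P(y,b(x))$ from $y$ to $b(x)$ and $P(z,b(x))$ from $z$ to $b(x)$, both congruent to $P(x,s(x))$, such that $P(x,s(x))$ avoids both $P(y,b(x))$ and $P(z,b(x))$. *)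

theory Defs
  imports "Graph_Theory.Pair_Digraph"
begin

text \<open>
  A digraph is a \<^locale>\<open>pair_fin_digraph\<close>: a finite vertex set with a binary arc relation
  on it; loops are permitted.

  Functions on the vertex set are represented by total functions on the ambient type, whose values
  outside the vertex set are irrelevant.
\<close>

definition ternary_polymorphism :: "'a pair_pre_digraph \<Rightarrow> ('a \<Rightarrow> 'a \<Rightarrow> 'a \<Rightarrow> 'a) \<Rightarrow> bool" where
  "ternary_polymorphism H \<mu> \<longleftrightarrow>
     (\<forall>a\<in>pverts H. \<forall>b\<in>pverts H. \<forall>c\<in>pverts H. \<mu> a b c \<in> pverts H) \<and>
     (\<forall>u1 v1 u2 v2 u3 v3. (u1, v1) \<in> parcs H \<and> (u2, v2) \<in> parcs H \<and> (u3, v3) \<in> parcs H \<longrightarrow>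
        (\<mu> u1 u2 u3, \<mu> v1 v2 v3) \<in> parcs H)"

definition conservative :: "'a pair_pre_digraph \<Rightarrow> ('a \<Rightarrow> 'a \<Rightarrow> 'a \<Rightarrow> 'a) \<Rightarrow> bool" where
  "conservative H \<mu> \<longleftrightarrow>
     (\<forall>a\<in>pverts H. \<forall>b\<in>pverts H. \<forall>c\<in>pverts H. \<mu> a b c \<in> {a, b, c})"

definition majority :: "'a pair_pre_digraph \<Rightarrow> ('a \<Rightarrow> 'a \<Rightarrow> 'a \<Rightarrow> 'a) \<Rightarrow> bool" where
  "majority H \<mu> \<longleftrightarrow>
     (\<forall>a\<in>pverts H. \<forall>b\<in>pverts H. \<mu> a a b = a \<and> \<mu> a b a = a \<and> \<mu> b a a = a)"

datatype direction = Forward | Backward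

text \<open>
  A walk with \<open>n\<close> steps is the list of its \<open>n + 1\<close> vertices paired with the list of the \<open>n\<close>
  directions of its steps; \<open>n = 0\<close> is permitted.
\<close>

type_synonym 'a owalk = "'a list \<times> direction list"

definition owalk :: "'a pair_pre_digraph \<Rightarrow> 'a owalk \<Rightarrow> bool" where
  "owalk H P \<longleftrightarrow> (case P of (xs, ds) \<Rightarrow>
     length xs = Suc (length ds) \<and> set xs \<subseteq> pverts H \<and>
     (\<forall>i<length ds.
        (ds ! i = Forward \<longrightarrow> (xs ! i, xs ! Suc i) \<in> parcs H) \<and>
        (ds ! i = Backward \<longrightarrow> (xs ! Suc i, xs ! i) \<in> parcs H)))"

definition owalk_from_to :: "'a pair_pre_digraph \<Rightarrow> 'a \<Rightarrow> 'a owalk \<Rightarrow> 'a \<Rightarrow> bool" where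
  "owalk_from_to H x P y \<longleftrightarrow> owalk H P \<and> hd (fst P) = x \<and> last (fst P) = y"

definition owalk_congruent :: "'a owalk \<Rightarrow> 'a owalk \<Rightarrow> bool" where
  "owalk_congruent P Q \<longleftrightarrow> length (snd P) = length (snd Q) \<and>
     (\<forall>i<length (snd P). snd P ! i = Forward \<longleftrightarrow> snd Q ! i = Forward)"

text \<open>Avoidance is only meaningful for congruent walks, and it is not symmetric.\<close>

definition avoids :: "'a pair_pre_digraph \<Rightarrow> 'a owalk \<Rightarrow> 'a owalk \<Rightarrow> bool" where
  "avoids H P Q \<longleftrightarrow> (case (P, Q) of ((xs, ds), (ys, _)) \<Rightarrow>
     \<not> (\<exists>i<length ds. ds ! i = Forward \<and> (xs ! i, ys ! Suc i) \<in> parcs H) \<and>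
     \<not> (\<exists>i<length ds. ds ! i = Backward \<and> (ys ! Suc i, xs ! i) \<in> parcs H))"

text \<open>
  The six vertices \<open>s(u), b(u), s(v), b(v), s(w), b(w)\<close> are given by two functions, of which only
  the values at \<open>u\<close>, \<open>v\<close> and \<open>w\<close> matter.
\<close>

definition permutable_triple ::
  "'a pair_pre_digraph \<Rightarrow> 'a \<Rightarrow> 'a \<Rightarrow> 'a \<Rightarrow> ('a \<Rightarrow> 'a) \<Rightarrow> ('a \<Rightarrow> 'a) \<Rightarrow> bool" where
  "permutable_triple H u v w s b \<longleftrightarrow>
     distinct [u, v, w] \<and> {u, v, w} \<subseteq> pverts H \<and>
     (\<forall>x\<in>{u, v, w}. s x \<in> pverts H \<and> b x \<in> pverts H) \<and>
     (\<forall>x y z. {x, y, z} = {u, v, w} \<longrightarrow>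
        (\<exists>P Q R. owalk_from_to H x P (s x) \<and> owalk_from_to H y Q (b x) \<and> owalk_from_to H z R (b x) \<and>
           owalk_congruent Q P \<and> owalk_congruent R P \<and> avoids H P Q \<and> avoids H P R))"

end

theory Submission
  imports Defs
begin

text \<open>
  Call \<open>x\<close> separated from \<open>y, z\<close> if congruent walks lead from \<open>x, y, z\<close> to some \<open>s, b, b\<close>, the
  first avoiding the other two. Along such walks a conservative majority polymorphism that picks
  \<open>x\<close> is forced to pick \<open>s\<close> rather than \<open>b\<close> at the end; so no \<open>x\<close> separated from \<open>y, z\<close> can be
  chosen, and a permutable triple leaves no choice at all. Conversely, without permutable triples,
  let \<open>\<mu> u v w\<close> be the first of \<open>u, v, w\<close> that is not separated from the other two. If \<open>u\<close> and
  \<open>v'\<close> are unseparated in \<open>(u, v, w)\<close> and \<open>(u', v', w')\<close> and the arc \<open>uv'\<close> is missing, then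
  \<open>uw'\<close> and \<open>wv'\<close> are missing too, so \<open>u'\<close> and \<open>v\<close> are also unseparated, and choosing \<open>u\<close>
  in the first triple but \<open>v'\<close> in the second contradicts the choice of the first position.
\<close>

section \<open>Steps of walks and an inductive form of avoidance\<close>

fun arc_step :: "'a pair_pre_digraph \<Rightarrow> direction \<Rightarrow> 'a \<Rightarrow> 'a \<Rightarrow> bool" where
  "arc_step H Forward x y \<longleftrightarrow> (x, y) \<in> parcs H"
| "arc_step H Backward x y \<longleftrightarrow> (y, x) \<in> parcs H"

text \<open>Needed because one-step arguments are also run from the heads of the arcs back to their
  tails.\<close>

lemma arc_step_reverse: "\<exists>e. \<forall>x y. arc_step H e x y \<longleftrightarrow> arc_step H d y x"
  by (cases d) (auto intro: exI[of _ Forward] exI[of _ Backward])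

lemma arc_step_in_pverts:
  assumes "pair_fin_digraph H" "arc_step H d x y"
  shows "x \<in> pverts H" "y \<in> pverts H"
proof -
  interpret pair_fin_digraph H by fact
  show "x \<in> pverts H" "y \<in> pverts H"
    using assms(2) by (cases d; auto dest: in_arcsD1 in_arcsD2)+
qed

text \<open>The three walks grow together from the front; the common direction \<open>d\<close> of
  each step builds congruence in. Since \<open>s\<close> and \<open>b\<close> are parameters, an
  induction moves the starting vertices only.\<close>

inductive separated_to :: "'a pair_pre_digraph \<Rightarrow> 'a \<Rightarrow> 'a \<Rightarrow> 'a \<Rightarrow> 'a \<Rightarrow> 'a \<Rightarrow> bool"
  for H s b where
  stop: "s \<in> pverts H \<Longrightarrow> b \<in> pverts H \<Longrightarrow> separated_to H s b s b b"
| step: "arc_step H d x x' \<Longrightarrow> arc_step H d y y' \<Longrightarrow> arc_step H d z z' \<Longrightarrow>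
    \<not> arc_step H d x y' \<Longrightarrow> \<not> arc_step H d x z' \<Longrightarrow> separated_to H s b x' y' z' \<Longrightarrow>
    separated_to H s b x y z"

lemma separated_to_commute: "separated_to H s b x y z \<Longrightarrow> separated_to H s b x z y"
  by (induction rule: separated_to.induct) (auto intro: separated_to.intros)

lemma separated_to_in_pverts:
  "separated_to H s b x y z \<Longrightarrow> s \<in> pverts H \<and> b \<in> pverts H"
  by (induction rule: separated_to.induct) auto

lemma owalk_Nil: "owalk H (xs, []) \<longleftrightarrow> (\<exists>x\<in>pverts H. xs = [x])"
  by (auto simp: owalk_def length_Suc_conv)

lemma owalk_Cons:
  "owalk H (xs, d # ds) \<longleftrightarrow>
    (\<exists>x xs'. xs = x # xs' \<and> x \<in> pverts H \<and> arc_step H d x (hd xs') \<and> owalk H (xs', ds))"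
proof (cases xs)
  case (Cons x xs')
  then show ?thesis
    by (cases xs'; cases d) (auto simp: owalk_def less_Suc_eq_0_disj)
qed (simp add: owalk_def)

lemma avoids_iff_arc_step:
  "avoids H (xs, ds) (ys, es) \<longleftrightarrow> (\<forall>i<length ds. \<not> arc_step H (ds ! i) (xs ! i) (ys ! Suc i))"
proof -
  have "\<not> arc_step H d x y \<longleftrightarrow>
      \<not> (d = Forward \<and> (x, y) \<in> parcs H) \<and> \<not> (d = Backward \<and> (y, x) \<in> parcs H)" for d x y
    by (cases d) auto
  then show ?thesis
    by (simp add: avoids_def) blast
qed

lemma avoids_Nil: "avoids H (xs, []) (ys, es)"
  by (simp add: avoids_iff_arc_step)

lemma avoids_Cons:
  assumes "ys \<noteq> []"
  shows "avoids H (x # xs, d # ds) (y # ys, d # ds) \<longleftrightarrow>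
    \<not> arc_step H d x (hd ys) \<and> avoids H (xs, ds) (ys, ds)"
  using assms by (simp add: avoids_iff_arc_step All_less_Suc2 hd_conv_nth)

lemma owalk_nonempty: "owalk H (xs, ds) \<Longrightarrow> xs \<noteq> []"
  by (auto simp: owalk_def)

text \<open>With only two directions, agreeing on \<open>Forward\<close> is agreeing everywhere, so
  congruent walks can share one list of directions.\<close>

lemma owalk_congruent_iff: "owalk_congruent P Q \<longleftrightarrow> snd P = snd Q"
proof -
  have "(d = Forward \<longleftrightarrow> e = Forward) \<longleftrightarrow> d = e" for d e
    by (cases d; cases e) auto
  then have "owalk_congruent P Q \<longleftrightarrow>
      length (snd P) = length (snd Q) \<and> (\<forall>i<length (snd P). snd P ! i = snd Q ! i)"
    unfolding owalk_congruent_def by simp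
  then show ?thesis
    by (simp only: list_eq_iff_nth_eq)
qed

lemma separated_to_of_owalks:
  assumes "owalk_from_to H x (xs, ds) s" "owalk_from_to H y (ys, ds) b"
    "owalk_from_to H z (zs, ds) b" "avoids H (xs, ds) (ys, ds)" "avoids H (xs, ds) (zs, ds)"
  shows "separated_to H s b x y z"
  using assms
proof (induction ds arbitrary: x y z xs ys zs)
  case Nil
  then show ?case
    by (auto simp: owalk_from_to_def owalk_Nil intro: separated_to.stop)
next
  case (Cons d ds)
  from Cons.prems obtain xs' ys' zs' where
    eqs: "xs = x # xs'" "ys = y # ys'" "zs = z # zs'"
    and steps: "arc_step H d x (hd xs')" "arc_step H d y (hd ys')" "arc_step H d z (hd zs')"
    and walks: "owalk H (xs', ds)" "owalk H (ys', ds)" "owalk H (zs', ds)"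
    unfolding owalk_from_to_def owalk_Cons by (metis fst_conv list.sel(1))
  note ne = walks[THEN owalk_nonempty]
  from Cons.prems(4,5) have
    "\<not> arc_step H d x (hd ys') \<and> avoids H (xs', ds) (ys', ds)"
    "\<not> arc_step H d x (hd zs') \<and> avoids H (xs', ds) (zs', ds)"
    using eqs ne by (simp_all add: avoids_Cons)
  moreover from this have "separated_to H s b (hd xs') (hd ys') (hd zs')"
    using Cons.prems(1-3) eqs walks ne
    by (intro Cons.IH[of _ xs' _ ys' _ zs']) (auto simp: owalk_from_to_def)
  ultimately show ?case
    using steps by (blast intro: separated_to.step)
qed

lemma owalks_of_separated_to:
  assumes "pair_fin_digraph H" "separated_to H s b x y z"
  shows "\<exists>xs ys zs ds. owalk_from_to H x (xs, ds) s \<and> owalk_from_to H y (ys, ds) b \<and>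
    owalk_from_to H z (zs, ds) b \<and> avoids H (xs, ds) (ys, ds) \<and> avoids H (xs, ds) (zs, ds)"
  using assms(2)
proof (induction rule: separated_to.induct)
  case stop
  then show ?case
    by (intro exI[of _ "[s]"] exI[of _ "[b]"] exI[of _ "[]"])
      (auto simp: owalk_from_to_def owalk_Nil avoids_Nil)
next
  case (step d x x' y y' z z')
  then obtain xs ys zs ds where
    walks: "owalk_from_to H x' (xs, ds) s" "owalk_from_to H y' (ys, ds) b"
      "owalk_from_to H z' (zs, ds) b"
    and av: "avoids H (xs, ds) (ys, ds)" "avoids H (xs, ds) (zs, ds)"
    by blast
  from walks have ne: "xs \<noteq> []" "ys \<noteq> []" "zs \<noteq> []"
    by (auto simp: owalk_from_to_def dest: owalk_nonempty)
  have "x \<in> pverts H" "y \<in> pverts H" "z \<in> pverts H"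
    using step.hyps arc_step_in_pverts(1)[OF assms(1)] by blast+
  then have "owalk_from_to H x (x # xs, d # ds) s" "owalk_from_to H y (y # ys, d # ds) b"
    "owalk_from_to H z (z # zs, d # ds) b"
    using walks ne step.hyps by (auto simp: owalk_from_to_def owalk_Cons)
  moreover have "avoids H (x # xs, d # ds) (y # ys, d # ds)"
    "avoids H (x # xs, d # ds) (z # zs, d # ds)"
    using av walks ne step.hyps by (auto simp: owalk_from_to_def avoids_Cons)
  ultimately show ?case
    by blast
qed

lemma separated_to_iff_owalks:
  assumes "pair_fin_digraph H"
  shows "separated_to H s b x y z \<longleftrightarrow>
    (\<exists>P Q R. owalk_from_to H x P s \<and> owalk_from_to H y Q b \<and> owalk_from_to H z R b \<and>
      owalk_congruent Q P \<and> owalk_congruent R P \<and> avoids H P Q \<and> avoids H P R)"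
  (is "_ \<longleftrightarrow> ?walks")
proof
  assume "separated_to H s b x y z"
  then show ?walks
    using owalks_of_separated_to[OF assms] unfolding owalk_congruent_iff
    by (metis snd_conv)
next
  assume ?walks
  then show "separated_to H s b x y z"
    unfolding owalk_congruent_iff by (metis separated_to_of_owalks prod.collapse)
qed

section \<open>Permutable triples in terms of separation\<close>

definition separated :: "'a pair_pre_digraph \<Rightarrow> 'a \<Rightarrow> 'a \<Rightarrow> 'a \<Rightarrow> bool" where
  "separated H x y z \<longleftrightarrow> (\<exists>s b. separated_to H s b x y z)"

lemma separated_commute: "separated H x y z \<longleftrightarrow> separated H x z y"
  by (auto simp: separated_def intro: separated_to_commute)

text \<open>Walks without steps suffice. They serve as the final piece when two walks meet after one
  step.\<close>

lemma separated_refl: "x \<in> pverts H \<Longrightarrow> y \<in> pverts H \<Longrightarrow> separated H x y y"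
  by (auto simp: separated_def intro: separated_to.stop)

lemma separated_step:
  "arc_step H d x x' \<Longrightarrow> arc_step H d y y' \<Longrightarrow> arc_step H d z z' \<Longrightarrow>
    \<not> arc_step H d x y' \<Longrightarrow> \<not> arc_step H d x z' \<Longrightarrow> separated H x' y' z' \<Longrightarrow> separated H x y z"
  by (auto simp: separated_def intro: separated_to.step)

lemma permutable_triple_iff_separated:
  assumes "pair_fin_digraph H"
  shows "(\<exists>s b. permutable_triple H u v w s b) \<longleftrightarrow>
    distinct [u, v, w] \<and> {u, v, w} \<subseteq> pverts H \<and>
    separated H u v w \<and> separated H v u w \<and> separated H w u v"
  (is "_ \<longleftrightarrow> ?sep")
proof
  assume "\<exists>s b. permutable_triple H u v w s b"
  then obtain s b where *: "permutable_triple H u v w s b"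
    by blast
  then have "separated_to H (s x) (b x) x y z" if "{x, y, z} = {u, v, w}" for x y z
    using that unfolding permutable_triple_def separated_to_iff_owalks[OF assms] by blast
  then have "separated H x y z" if "{x, y, z} = {u, v, w}" for x y z
    using that unfolding separated_def by blast
  then have "separated H u v w" "separated H v u w" "separated H w u v"
    by auto
  then show ?sep
    using * unfolding permutable_triple_def by blast
next
  assume sep: ?sep
  obtain su bu sv bv sw bw where to:
    "separated_to H su bu u v w" "separated_to H sv bv v u w" "separated_to H sw bw w u v"
    using sep by (auto simp: separated_def)
  \<comment> \<open>The three separations may end in different vertices; as \<open>u\<close>,
    \<open>v\<close>, \<open>w\<close> are distinct, these can be glued into functions.\<close>
  define s where "s x = (if x = u then su else if x = v then sv else sw)" for x
  define b where "b x = (if x = u then bu else if x = v then bv else bw)" for x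
  have to': "separated_to H (s x) (b x) x y z" if "{x, y, z} = {u, v, w}" for x y z
  proof -
    have "set [x, y, z] = {u, v, w}"
      using that by simp
    \<comment> \<open>Three entries that form a set of size three cannot repeat. Hence only the six
      orderings occur: the three in \<open>to\<close> and their swaps.\<close>
    then have "distinct [x, y, z]"
      using sep by (intro card_distinct) simp
    moreover have "x \<in> {u, v, w}" "y \<in> {u, v, w}" "z \<in> {u, v, w}"
      using that by blast+
    ultimately show ?thesis
      using to to[THEN separated_to_commute] sep unfolding s_def b_def
      by (elim insertE emptyE; simp)
  qed
  have "\<forall>x\<in>{u, v, w}. s x \<in> pverts H \<and> b x \<in> pverts H"
    using to[THEN separated_to_in_pverts] by (auto simp: s_def b_def)
  then have "permutable_triple H u v w s b"
    using sep to' unfolding permutable_triple_def separated_to_iff_owalks[OF assms] by blast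
  then show "\<exists>s b. permutable_triple H u v w s b"
    by blast
qed

section \<open>A conservative majority polymorphism excludes permutable triples\<close>

lemma ternary_polymorphism_arc_step:
  assumes "ternary_polymorphism H \<mu>"
    "arc_step H d x x'" "arc_step H d y y'" "arc_step H d z z'"
  shows "arc_step H d (\<mu> x y z) (\<mu> x' y' z')"
  using assms by (cases d) (auto simp: ternary_polymorphism_def)

text \<open>Induction from the far end of the walks, where majority gives
  \<open>\<mu> s b b = b\<close>. One step earlier, the value \<open>x\<close> would need an arc to
  \<open>y'\<close> or \<open>z'\<close>, which avoidance forbids.\<close>

lemma conservative_majority_avoids_separated:
  assumes H: "pair_fin_digraph H"
    and \<mu>: "ternary_polymorphism H \<mu>" "conservative H \<mu>" "majority H \<mu>"
    and "separated H x y z" "x \<noteq> y" "x \<noteq> z"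
  shows "\<mu> x y z \<noteq> x"
proof -
  obtain s b where "separated_to H s b x y z"
    using assms(5) by (auto simp: separated_def)
  then show ?thesis
    using assms(6,7)
  proof (induction rule: separated_to.induct)
    case stop
    then show ?case
      using \<mu>(3) by (auto simp: majority_def)
  next
    case (step d x x' y y' z z')
    \<comment> \<open>The induction hypothesis applies since \<open>x'\<close> differs from
      \<open>y'\<close> and \<open>z'\<close>: \<open>x\<close> has a step to \<open>x'\<close> but
      to neither of the others.\<close>
    then have IH: "\<mu> x' y' z' \<noteq> x'"
      by auto
    have "x' \<in> pverts H" "y' \<in> pverts H" "z' \<in> pverts H"
      using step.hyps arc_step_in_pverts(2)[OF H] by blast+
    with IH \<mu>(2) have "\<mu> x' y' z' = y' \<or> \<mu> x' y' z' = z'"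
      by (auto simp: conservative_def)
    with ternary_polymorphism_arc_step[OF \<mu>(1) step.hyps(1-3)] step.hyps(4,5) show ?case
      by metis
  qed
qed

text \<open>Brings the second or third argument to the front: \<open>\<nu> v u w\<close> and
  \<open>\<rho> w u v\<close> both equal \<open>\<mu> u v w\<close>, so a result about the first
  position covers all three.\<close>

lemma conservative_majority_swap:
  assumes "ternary_polymorphism H \<mu>" "conservative H \<mu>" "majority H \<mu>"
  defines "\<nu> \<equiv> \<lambda>a b c. \<mu> b a c" and "\<rho> \<equiv> \<lambda>a b c. \<mu> b c a"
  shows "ternary_polymorphism H \<nu>" "conservative H \<nu>" "majority H \<nu>"
    "ternary_polymorphism H \<rho>" "conservative H \<rho>" "majority H \<rho>"
  using assms(1-3) unfolding \<nu>_def \<rho>_def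
  by (simp_all add: ternary_polymorphism_def conservative_def majority_def) blast+

section \<open>The first unseparated vertex as a polymorphism\<close>

lemma unseparated_arc_to_repeated:
  assumes "pair_fin_digraph H"
    and "arc_step H d u u'" "arc_step H d v v'" "arc_step H d w v'" "\<not> separated H u v w"
  shows "arc_step H d u v'"
  \<comment> \<open>Were the arc missing, one step would lead to \<open>u'\<close>,
    \<open>v'\<close>, \<open>v'\<close>, which are separated by walks of length zero.\<close>
  using assms arc_step_in_pverts separated_refl separated_step by metis

text \<open>Once the arcs from \<open>u\<close> to \<open>w'\<close> and from \<open>w\<close> to
  \<open>v'\<close> are excluded too, a separation of \<open>v\<close> would extend backwards over
  the reversed arcs to one of \<open>v'\<close>, and a separation of \<open>u'\<close> over the arcs
  themselves to one of \<open>u\<close>.\<close>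

lemma unseparated_crossing:
  assumes H: "pair_fin_digraph H"
    and steps: "arc_step H d u u'" "arc_step H d v v'" "arc_step H d w w'"
    and unsep: "\<not> separated H u v w" "\<not> separated H v' u' w'"
    and no_arc: "\<not> arc_step H d u v'"
  shows "\<not> separated H v u w" "\<not> separated H u' v' w'"
proof -
  obtain e where e: "\<And>x y. arc_step H e x y \<longleftrightarrow> arc_step H d y x"
    using arc_step_reverse by metis
  have "\<not> arc_step H d w v'"
    using unseparated_arc_to_repeated[OF H steps(1,2)] unsep(1) no_arc by blast
  moreover have "\<not> arc_step H d u w'"
    using unseparated_arc_to_repeated[OF H, of e v' v u' u w'] unsep(2) no_arc steps e by blast
  ultimately show "\<not> separated H v u w" "\<not> separated H u' v' w'"
    using separated_step[of H e v' v u' u w' w] separated_step[of H d u u' v v' w w']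
      steps unsep no_arc e by blast+
qed

text \<open>Repetitions are settled first, which makes it a majority function. The last
  \<open>w\<close> needs no test: without permutable triples it is unseparated whenever it is
  reached.\<close>

definition first_unseparated :: "'a pair_pre_digraph \<Rightarrow> 'a \<Rightarrow> 'a \<Rightarrow> 'a \<Rightarrow> 'a" where
  "first_unseparated H u v w =
    (if u = v \<or> u = w then u else if v = w then v
     else if \<not> separated H u v w then u else if \<not> separated H v u w then v else w)"

text \<open>The repeated value is the target. A chosen vertex in one of the two repeating positions
  has its own arc there; one in the remaining position is unseparated or equals another entry, and
  so also has an arc there.\<close>

lemma first_unseparated_arc_step_repeated:
  assumes H: "pair_fin_digraph H"
    and unsep: "distinct [u, v, w] \<Longrightarrow>
      \<not> (separated H u v w \<and> separated H v u w \<and> separated H w u v)"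
    and steps: "arc_step H d u u'" "arc_step H d v v'" "arc_step H d w w'"
    and repeated: "\<not> distinct [u', v', w']"
  shows "arc_step H d (first_unseparated H u v w) (first_unseparated H u' v' w')"
proof -
  note arc = unseparated_arc_to_repeated[OF H, of d]
  consider "v' = w'" | "u' = w'" | "u' = v'"
    using repeated by auto
  then show ?thesis
  proof cases
    case 1
    then show ?thesis
      using steps unsep arc[of u u' v v' w]
      by (auto simp: first_unseparated_def)
  next
    case 2
    then show ?thesis
      using steps unsep arc[of v v' u u' w]
      by (auto simp: first_unseparated_def)
  next
    \<comment> \<open>Here the choice may fall on the untested \<open>w\<close>;
      \<open>unsep\<close> shows that it is unseparated.\<close>
    case 3
    then show ?thesis
      using steps unsep arc[of w w' u u' v]
      by (auto simp: first_unseparated_def)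
  qed
qed

lemma first_unseparated_arc_step:
  assumes H: "pair_fin_digraph H"
    and unsep: "\<And>u v w. distinct [u, v, w] \<Longrightarrow> {u, v, w} \<subseteq> pverts H \<Longrightarrow>
      \<not> (separated H u v w \<and> separated H v u w \<and> separated H w u v)"
    and steps: "arc_step H d u u'" "arc_step H d v v'" "arc_step H d w w'"
  shows "arc_step H d (first_unseparated H u v w) (first_unseparated H u' v' w')"
proof -
  obtain e where e: "\<And>x y. arc_step H e x y \<longleftrightarrow> arc_step H d y x"
    using arc_step_reverse by metis
  have "{u, v, w} \<subseteq> pverts H" "{u', v', w'} \<subseteq> pverts H"
    using steps arc_step_in_pverts[OF H] by blast+
  note un = unsep[OF _ this(1)] unsep[OF _ this(2)]
  consider "\<not> distinct [u', v', w']" | "\<not> distinct [u, v, w]"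
    | "distinct [u, v, w]" "distinct [u', v', w']"
    by blast
  then show ?thesis
  proof cases
    case 1
    then show ?thesis
      using first_unseparated_arc_step_repeated[OF H un(1) steps] by blast
  next
    case 2
    \<comment> \<open>A repetition among the tails becomes one among the heads when all arcs are
      reversed.\<close>
    then show ?thesis
      using first_unseparated_arc_step_repeated[OF H un(2), of e] steps e by blast
  next
    case 3
    have eqs: "first_unseparated H u v w = (if \<not> separated H u v w then u
        else if \<not> separated H v u w then v else w)"
      "first_unseparated H u' v' w' = (if \<not> separated H u' v' w' then u'
        else if \<not> separated H v' u' w' then v' else w')"
      using 3 by (simp_all add: first_unseparated_def)
    note cross = unseparated_crossing[OF H, of d]
    \<comment> \<open>One crossing statement for each ordered pair of different positions;
      \<open>separated_commute\<close> adjusts the order of the last two arguments.\<close>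
    have "\<not> separated H v u w \<and> \<not> separated H u' v' w'"
      if "\<not> separated H u v w" "\<not> separated H v' u' w'" "\<not> arc_step H d u v'"
      using that cross[OF steps] by (metis separated_commute)
    moreover have "\<not> separated H u v w \<and> \<not> separated H v' u' w'"
      if "\<not> separated H v u w" "\<not> separated H u' v' w'" "\<not> arc_step H d v u'"
      using that cross[OF steps(2,1,3)] by (metis separated_commute)
    moreover have "\<not> separated H w u v \<and> \<not> separated H u' v' w'"
      if "\<not> separated H u v w" "\<not> separated H w' u' v'" "\<not> arc_step H d u w'"
      using that cross[OF steps(1,3,2)] by (metis separated_commute)
    moreover have "\<not> separated H u v w \<and> \<not> separated H w' u' v'"
      if "\<not> separated H w u v" "\<not> separated H u' v' w'" "\<not> arc_step H d w u'"
      using that cross[OF steps(3,1,2)] by (metis separated_commute)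
    moreover have "\<not> separated H w u v \<and> \<not> separated H v' u' w'"
      if "\<not> separated H v u w" "\<not> separated H w' u' v'" "\<not> arc_step H d v w'"
      using that cross[OF steps(2,3,1)] by (metis separated_commute)
    moreover have "\<not> separated H v u w \<and> \<not> separated H w' u' v'"
      if "\<not> separated H w u v" "\<not> separated H v' u' w'" "\<not> arc_step H d w v'"
      using that cross[OF steps(3,2,1)] by (metis separated_commute)
    \<comment> \<open>Equal positions are joined by a given arc. If different positions are chosen
      and the arc is missing, both are unseparated in both triples, so the later one was not the
      first unseparated position in its triple.\<close>
    ultimately show ?thesis
      using un(1)[OF 3(1)] un(2)[OF 3(2)] steps unfolding eqs by (smt (verit))
  qed
qed

theorem theorem6:
  fixes H :: "'a pair_pre_digraph"
  assumes "pair_fin_digraph H"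
  shows "(\<exists>\<mu>. ternary_polymorphism H \<mu> \<and> conservative H \<mu> \<and> majority H \<mu>) \<longleftrightarrow>
         \<not> (\<exists>u v w s b. permutable_triple H u v w s b)"
proof
  assume "\<exists>\<mu>. ternary_polymorphism H \<mu> \<and> conservative H \<mu> \<and> majority H \<mu>"
  then obtain \<mu> where \<mu>: "ternary_polymorphism H \<mu>" "conservative H \<mu>" "majority H \<mu>"
    by blast
  show "\<not> (\<exists>u v w s b. permutable_triple H u v w s b)"
  proof
    assume "\<exists>u v w s b. permutable_triple H u v w s b"
    then obtain u v w where dist: "distinct [u, v, w]" and verts: "{u, v, w} \<subseteq> pverts H"
      and sep: "separated H u v w" "separated H v u w" "separated H w u v"
      using permutable_triple_iff_separated[OF assms] by metis
    note swap = conservative_majority_swap[OF \<mu>]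
    note avoids = conservative_majority_avoids_separated[OF assms]
    have "\<mu> u v w \<noteq> u" "\<mu> u v w \<noteq> v" "\<mu> u v w \<noteq> w"
      using avoids[OF \<mu> sep(1)] avoids[OF swap(1-3) sep(2)] avoids[OF swap(4-6) sep(3)] dist
      by auto
    then show False
      using \<mu>(2) verts by (auto simp: conservative_def)
  qed
next
  assume "\<not> (\<exists>u v w s b. permutable_triple H u v w s b)"
  then have unsep: "\<not> (separated H u v w \<and> separated H v u w \<and> separated H w u v)"
    if "distinct [u, v, w]" "{u, v, w} \<subseteq> pverts H" for u v w
    using permutable_triple_iff_separated[OF assms, of u v w] that by blast
  have "ternary_polymorphism H (first_unseparated H)"
    \<comment> \<open>Arcs are exactly the \<open>Forward\<close> steps; \<open>Backward\<close> was
      needed only for the walks and for the reversals.\<close>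
    using first_unseparated_arc_step[OF assms unsep, of Forward]
    by (auto simp: ternary_polymorphism_def first_unseparated_def)
  moreover have "conservative H (first_unseparated H)" "majority H (first_unseparated H)"
    by (auto simp: conservative_def majority_def first_unseparated_def)
  ultimately show "\<exists>\<mu>. ternary_polymorphism H \<mu> \<and> conservative H \<mu> \<and> majority H \<mu>"
    by blast
qed

end
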